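(* Let $A=(a_{i,j})\in\mathcal{S}^n$. There is a diagonal matrix $D$ with positive diagonal entries such that $DAD\in\mathcal{M}_n$ if and only if the following system of linear inequalities in $d=(d_1,\dots,d_n)\in\mathbb{R}^n$ is feasible: $$d_k a_{i,k}-d_j a_{i,j}\ge 0\ \text{ for all } i,j,k\in\{1,\dots,n\} \text{ with } j<k,\ i\neq j,\ i\neq k,\qquad d_i\ge 1\ \text{ for all } i\in\{1,\dots,n\}.$$ Moreover, if $d$ is a feasible solution of this system, then $D=\mathrm{diag}(d_1,d_2,\dots,d_n)$ satisfies $DAD\in\mathcal{M}_n$.
   Context: $\mathcal{S}^n$ is the set of real symmetric $n\times n$ matrices. $\mathcal{M}_n=\{A=(a_{i,j})\in\mathcal{S}^n : a_{i,j}\le a_{k,\ell} \text{ whenever } i\le k,\ j\le \ell,\ i\neq j,\ k\neq \ell\}$. *)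

theory Defs
  imports "Jordan_Normal_Form.Matrix"
begin

(* Row and column indices run over 0, ..., n - 1, instead of 1, ..., n. *)

definition symmetric_mats :: "nat \<Rightarrow> real mat set" where
  "symmetric_mats n = {A \<in> carrier_mat n n. transpose_mat A = A}"

definition monotone_mats :: "nat \<Rightarrow> real mat set" where
  "monotone_mats n =
     {A \<in> symmetric_mats n.
        \<forall>i<n. \<forall>j<n. \<forall>k<n. \<forall>l<n.
          i \<le> k \<longrightarrow> j \<le> l \<longrightarrow> i \<noteq> j \<longrightarrow> k \<noteq> l \<longrightarrow> A $$ (i, j) \<le> A $$ (k, l)}"

definition feasible_scaling :: "nat \<Rightarrow> real mat \<Rightarrow> real vec \<Rightarrow> bool" where
  "feasible_scaling n A d \<longleftrightarrow>
     d \<in> carrier_vec n \<and>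
     (\<forall>i<n. \<forall>j<n. \<forall>k<n.
        j < k \<longrightarrow> i \<noteq> j \<longrightarrow> i \<noteq> k \<longrightarrow> d $ k * A $$ (i, k) - d $ j * A $$ (i, j) \<ge> 0) \<and>
     (\<forall>i<n. d $ i \<ge> 1)"

end

theory Submission
  imports Defs
begin

text \<open>
  For \<open>B = D A D\<close> with \<open>D = diag(d)\<close>, the entries are \<open>b(i,j) = d(i) a(i,j) d(j)\<close>. If \<open>d\<close> is positive,
  cancelling \<open>d(i)\<close> turns \<open>d(k) a(i,k) \<ge> d(j) a(i,j)\<close> into \<open>b(i,j) \<le> b(i,k)\<close>. The linear
  inequalities thus say that the off-diagonal entries of each row of \<open>B\<close> are nondecreasing.
  For a symmetric matrix this is already the full monotonicity (\<open>monotone_mats_iff_rows\<close>): an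
  off-diagonal position \<open>(i,j)\<close> is joined to an off-diagonal position \<open>(k,l)\<close> with \<open>i \<le> k\<close>,
  \<open>j \<le> l\<close> by one move within a row and one within a column, passing through \<open>(i,l)\<close> or \<open>(k,j)\<close>.
  These corners cannot both be diagonal, since \<open>i = l\<close> and \<open>k = j\<close> would give
  \<open>i \<le> k = j \<le> l = i\<close>, hence \<open>i = j\<close>. Finally, the first family of inequalities is homogeneous
  in \<open>d\<close>, so any positive solution can be rescaled to satisfy \<open>d(i) \<ge> 1\<close>.
\<close>

lemma symmetric_mats_iff:
  "A \<in> symmetric_mats n \<longleftrightarrow>
    A \<in> carrier_mat n n \<and> (\<forall>i<n. \<forall>j<n. A $$ (i, j) = A $$ (j, i))"
proof
  assume "A \<in> symmetric_mats n"
  then have "A \<in> carrier_mat n n" "transpose_mat A = A"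
    unfolding symmetric_mats_def by auto
  then show "A \<in> carrier_mat n n \<and> (\<forall>i<n. \<forall>j<n. A $$ (i, j) = A $$ (j, i))"
    by (metis carrier_matD index_transpose_mat(1))
next
  assume "A \<in> carrier_mat n n \<and> (\<forall>i<n. \<forall>j<n. A $$ (i, j) = A $$ (j, i))"
  then show "A \<in> symmetric_mats n"
    unfolding symmetric_mats_def by auto
qed

lemma monotone_mats_iff_rows:
  assumes B: "B \<in> symmetric_mats n"
  shows "B \<in> monotone_mats n \<longleftrightarrow>
    (\<forall>i<n. \<forall>j<n. \<forall>k<n. j < k \<longrightarrow> i \<noteq> j \<longrightarrow> i \<noteq> k \<longrightarrow> B $$ (i, j) \<le> B $$ (i, k))"
    (is "_ \<longleftrightarrow> ?rows")
proof
  assume "B \<in> monotone_mats n"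
  then show ?rows
    unfolding monotone_mats_def by auto
next
  assume rows: ?rows
  have row: "B $$ (i, j) \<le> B $$ (i, k)"
    if "i < n" "j < n" "k < n" "j \<le> k" "i \<noteq> j" "i \<noteq> k" for i j k
    using rows that by (cases "j = k") auto
  have sym: "B $$ (i, j) = B $$ (j, i)" if "i < n" "j < n" for i j
    using B that by (simp add: symmetric_mats_iff)
  have col: "B $$ (i, j) \<le> B $$ (k, j)"
    if "i < n" "j < n" "k < n" "i \<le> k" "i \<noteq> j" "k \<noteq> j" for i j k
    using row[of j i k] sym that by auto
  have "B $$ (i, j) \<le> B $$ (k, l)"
    if "i < n" "j < n" "k < n" "l < n" "i \<le> k" "j \<le> l" "i \<noteq> j" "k \<noteq> l" for i j k l
  proof (cases "i = l")
    case False
    then show ?thesis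
      using row[of i j l] col[of i l k] that by auto
  next
    case True
    then have "k \<noteq> j"
      using that by auto
    then show ?thesis
      using col[of i j k] row[of k j l] that by auto
  qed
  then show "B \<in> monotone_mats n"
    using B unfolding monotone_mats_def by auto
qed

lemma index_mat_diag_scaling:
  fixes A :: "'a :: comm_ring_1 mat"
  assumes "A \<in> carrier_mat n n" "i < n" "j < n"
  shows "(mat_diag n f * A * mat_diag n f) $$ (i, j) = f i * A $$ (i, j) * f j"
  using assms by (simp add: mat_diag_mult_left[of A n n] mat_diag_mult_right[of _ n n])

lemma mat_diag_scaling_symmetric:
  assumes "A \<in> symmetric_mats n"
  shows "mat_diag n f * A * mat_diag n f \<in> symmetric_mats n"
proof -
  have A: "A \<in> carrier_mat n n" and "\<And>i j. \<lbrakk>i < n; j < n\<rbrakk> \<Longrightarrow> A $$ (i, j) = A $$ (j, i)"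
    using assms unfolding symmetric_mats_iff by auto
  moreover have "mat_diag n f * A * mat_diag n f \<in> carrier_mat n n"
    using A by (metis mat_diag_dim mult_carrier_mat)
  ultimately show ?thesis
    by (simp add: symmetric_mats_iff index_mat_diag_scaling del: index_mult_mat(1))
qed

lemma mat_diag_scaling_monotone_iff:
  assumes A: "A \<in> symmetric_mats n" and pos: "\<And>i. i < n \<Longrightarrow> f i > 0"
  shows "mat_diag n f * A * mat_diag n f \<in> monotone_mats n \<longleftrightarrow>
    (\<forall>i<n. \<forall>j<n. \<forall>k<n. j < k \<longrightarrow> i \<noteq> j \<longrightarrow> i \<noteq> k \<longrightarrow> f j * A $$ (i, j) \<le> f k * A $$ (i, k))"
proof -
  have carr: "A \<in> carrier_mat n n"
    using A unfolding symmetric_mats_def by auto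
  have "f i * A $$ (i, j) * f j \<le> f i * A $$ (i, k) * f k \<longleftrightarrow>
      f j * A $$ (i, j) \<le> f k * A $$ (i, k)" if "i < n" for i j k
    using mult_le_cancel_left_pos[OF pos[OF that], of "f j * A $$ (i, j)" "f k * A $$ (i, k)"]
    by (simp add: ac_simps)
  then show ?thesis
    by (simp add: monotone_mats_iff_rows mat_diag_scaling_symmetric A index_mat_diag_scaling carr
        del: index_mult_mat(1))
qed

lemma diagonal_mat_eq_mat_diag:
  assumes "D \<in> carrier_mat n n" "diagonal_mat D"
  shows "D = mat_diag n (\<lambda>i. D $$ (i, i))"
  using assms by (intro eq_matI) (auto simp: mat_diag_def diagonal_mat_def)

lemma feasible_scaling_monotone:
  assumes "A \<in> symmetric_mats n" "feasible_scaling n A d"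
  shows "mat_diag n (\<lambda>i. d $ i) * A * mat_diag n (\<lambda>i. d $ i) \<in> monotone_mats n"
proof -
  have "d $ i > 0" if "i < n" for i
    using assms(2) that unfolding feasible_scaling_def by force
  then show ?thesis
    using assms mat_diag_scaling_monotone_iff[of A n "\<lambda>i. d $ i"]
    unfolding feasible_scaling_def by auto
qed

lemma feasible_scaling_of_positive:
  assumes pos: "\<And>i. i < n \<Longrightarrow> f i > 0"
    and ineq: "\<And>i j k. \<lbrakk>i < n; j < n; k < n; j < k; i \<noteq> j; i \<noteq> k\<rbrakk> \<Longrightarrow>
      f j * A $$ (i, j) \<le> f k * A $$ (i, k)"
  shows "\<exists>d. feasible_scaling n A d"
proof
  \<comment> \<open>The factor \<open>c\<close> dominates every \<open>1 / f i\<close>; unlike the reciprocal of the minimum of \<open>f\<close>,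
    it needs no separate treatment of \<open>n = 0\<close>.\<close>
  define c where "c = (\<Sum>i<n. 1 / f i)"
  have c0: "c \<ge> 0"
    unfolding c_def using pos by (intro sum_nonneg) (simp add: less_imp_le)
  have "c * f i \<ge> 1" if "i < n" for i
  proof -
    have "1 / f i \<le> c"
      unfolding c_def using that pos by (intro member_le_sum) (auto simp: less_imp_le)
    then show ?thesis
      using pos[OF that] by (simp add: field_simps)
  qed
  moreover have "c * f j * A $$ (i, j) \<le> c * f k * A $$ (i, k)"
    if "i < n" "j < n" "k < n" "j < k" "i \<noteq> j" "i \<noteq> k" for i j k
    using mult_left_mono[OF ineq[OF that] c0] by (simp add: mult.assoc)
  ultimately show "feasible_scaling n A (vec n (\<lambda>i. c * f i))"
    unfolding feasible_scaling_def by auto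
qed

theorem proposition4p7:
  fixes n :: nat and A :: "real mat"
  assumes "A \<in> symmetric_mats n"
  shows "((\<exists>D \<in> carrier_mat n n. diagonal_mat D \<and> (\<forall>i<n. D $$ (i, i) > 0) \<and>
             D * A * D \<in> monotone_mats n)
          \<longleftrightarrow> (\<exists>d. feasible_scaling n A d))
       \<and> (\<forall>d. feasible_scaling n A d \<longrightarrow>
             mat_diag n (\<lambda>i. d $ i) * A * mat_diag n (\<lambda>i. d $ i) \<in> monotone_mats n)"
proof (intro conjI iffI allI impI)
  assume "\<exists>D \<in> carrier_mat n n. diagonal_mat D \<and> (\<forall>i<n. D $$ (i, i) > 0) \<and>
             D * A * D \<in> monotone_mats n"
  then obtain D where D: "D \<in> carrier_mat n n" "diagonal_mat D"
    and pos: "\<And>i. i < n \<Longrightarrow> D $$ (i, i) > 0" and mono: "D * A * D \<in> monotone_mats n"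
    by auto
  define f where "f = (\<lambda>i. D $$ (i, i))"
  have "D = mat_diag n f"
    using diagonal_mat_eq_mat_diag[OF D] unfolding f_def .
  then have "mat_diag n f * A * mat_diag n f \<in> monotone_mats n"
    using mono by simp
  moreover have fpos: "f i > 0" if "i < n" for i
    using pos that by (simp add: f_def)
  ultimately show "\<exists>d. feasible_scaling n A d"
    using mat_diag_scaling_monotone_iff[OF assms, of f]
    by (intro feasible_scaling_of_positive[of n f]) auto
next
  assume "\<exists>d. feasible_scaling n A d"
  then obtain d where d: "feasible_scaling n A d" ..
  have "d $ i > 0" if "i < n" for i
    using d that unfolding feasible_scaling_def by force
  then show "\<exists>D \<in> carrier_mat n n. diagonal_mat D \<and> (\<forall>i<n. D $$ (i, i) > 0) \<and>
             D * A * D \<in> monotone_mats n"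
    using feasible_scaling_monotone[OF assms d]
    by (intro bexI[of _ "mat_diag n (\<lambda>i. d $ i)"]) (auto simp: diagonal_mat_def mat_diag_def)
next
  fix d assume "feasible_scaling n A d"
  then show "mat_diag n (\<lambda>i. d $ i) * A * mat_diag n (\<lambda>i. d $ i) \<in> monotone_mats n"
    by (rule feasible_scaling_monotone[OF assms])
qed

end
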